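(* The online algorithm $\textsc{Move-Half}$ is dynamically optimal, i.e., there is a constant $c$ such that for every request sequence $\sigma$, $\mathrm{cost}(\textsc{Move-Half}(\sigma)) \le c\cdot \mathrm{cost}(\textsc{Opt}(\sigma))$.
   Context: Self-adjusting complete tree model: a set $V$ of $n$ items is stored in a complete binary tree of $n$ servers, one item per server; the root has depth $0$ and an item's depth is that of its hosting server. Requests $\sigma=(\sigma^{(1)},\sigma^{(2)},\dots)$ to items are revealed online and originate at the root. Serving a request to an item at depth $d$ costs $d$ (access cost); a swap, exchanging the items of a server and its parent, costs $1$ (adjustment cost); the cost of an algorithm on $\sigma$ is the total of access and adjustment costs. Two items $u,v$ can be interchanged (all other items stay in place) by swapping $u$ along the tree path to $v$'s server and then $v$ back along the same path to $u$'s original server. $\textsc{Opt}$ denotes an optimal offline algorithm that knows $\sigma$ in advance. The rank of an item $v$ at time $t$ is the number of distinct items requested since the last request of $v$ before $t$, including $v$. Algorithm $\textsc{Move-Half}$: it starts from the same tree as $\textsc{Opt}$, assumed to be an MRU tree (every item $v$ has depth $\lfloor \log_2 v.\mathrm{rank}\rfloor$). Upon a request to item $u$ at depth $d$, it accesses $u$ (cost $d$), lets $v$ be the item of highest rank among the items at depth $\lfloor d/2\rfloor$, and interchanges $u$ and $v$ via swaps along the tree path between them. *)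

theory Defs
  imports Complex_Main "HOL-Combinatorics.Transposition"
begin

text \<open>
  The servers of the complete binary tree with n nodes are the numbers 1, ..., n in heap order:
  the root is 1 and the parent of a server s > 1 is s div 2 (so the last level of the tree is
  filled from the left, and the tree is perfect iff n + 1 is a power of 2).
  A configuration maps every item to the server hosting it; for an item set V it is
  a bijection from V onto {1..n}.
\<close>

fun depth :: "nat \<Rightarrow> nat" where
  "depth s = (if s \<le> 1 then 0 else Suc (depth (s div 2)))"

declare depth.simps [simp del]

type_synonym 'a config = "'a \<Rightarrow> nat"

definition swap_parent :: "nat \<Rightarrow> 'a config \<Rightarrow> 'a config" where
  "swap_parent s pos = transpose s (s div 2) \<circ> pos"

text \<open>
  The work of an algorithm is a sequence of elementary actions; \<open>Swap s\<close> exchanges the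
  items of the server s and of its parent.
\<close>

datatype 'a action = Access 'a | Swap nat

fun perform :: "'a action \<Rightarrow> 'a config \<Rightarrow> 'a config" where
  "perform (Access v) pos = pos"
| "perform (Swap s) pos = swap_parent s pos"

fun action_cost :: "'a config \<Rightarrow> 'a action \<Rightarrow> nat" where
  "action_cost pos (Access v) = depth (pos v)"
| "action_cost pos (Swap s) = 1"

fun total_cost :: "'a config \<Rightarrow> 'a action list \<Rightarrow> nat" where
  "total_cost pos [] = 0"
| "total_cost pos (a # as) = action_cost pos a + total_cost (perform a pos) as"

fun accesses :: "'a action list \<Rightarrow> 'a list" where
  "accesses [] = []"
| "accesses (Access v # as) = v # accesses as"
| "accesses (Swap s # as) = accesses as"

definition serves :: "nat \<Rightarrow> 'a list \<Rightarrow> 'a action list \<Rightarrow> bool" where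
  "serves n \<sigma> as \<longleftrightarrow> accesses as = \<sigma> \<and> (\<forall>s. Swap s \<in> set as \<longrightarrow> 2 \<le> s \<and> s \<le> n)"

text \<open>
  An optimal offline algorithm may adjust the tree at any time, before as well as after
  an access.
\<close>

definition opt_cost :: "nat \<Rightarrow> 'a config \<Rightarrow> 'a list \<Rightarrow> nat" where
  "opt_cost n pos \<sigma> = Inf {total_cost pos as | as. serves n \<sigma> as}"

lemma opt_cost_attained: "\<exists>as. serves n \<sigma> as \<and> total_cost pos as = opt_cost n pos \<sigma>"
proof -
  have acc: "accesses (map Access \<sigma>) = \<sigma>" by (induction \<sigma>) auto
  have "serves n \<sigma> (map Access \<sigma>)" unfolding serves_def acc by auto
  then have "{total_cost pos as | as. serves n \<sigma> as} \<noteq> {}" by blast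
  from Inf_nat_def1[OF this] show ?thesis unfolding opt_cost_def by auto
qed

text \<open>
  The rank is taken with respect to the list h of all past requests, oldest first.
\<close>

definition rank :: "'a list \<Rightarrow> 'a \<Rightarrow> nat" where
  "rank h v = card (insert v (set (takeWhile (\<lambda>w. w \<noteq> v) (rev h))))"

definition mru_tree :: "'a set \<Rightarrow> 'a list \<Rightarrow> 'a config \<Rightarrow> bool" where
  "mru_tree V h pos \<longleftrightarrow> (\<forall>v\<in>V. int (depth (pos v)) = \<lfloor>log 2 (real (rank h v))\<rfloor>)"

text \<open>
  The edges of the tree path from i to j, in order, each represented by its child end.
\<close>

fun path_edges :: "nat \<Rightarrow> nat \<Rightarrow> nat list" where
  "path_edges i j =
     (if i = j then []
      else if j < i then i # path_edges (i div 2) j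
      else path_edges i (j div 2) @ [j])"

declare path_edges.simps [simp del]

text \<open>
  The item at server i is moved along the whole path to server j; this leaves the item from j
  one step before j, from where it is moved back along the rest of the path to i.
\<close>

definition interchange :: "nat \<Rightarrow> nat \<Rightarrow> nat list" where
  "interchange i j = path_edges i j @ tl (rev (path_edges i j))"

definition half_partner :: "'a set \<Rightarrow> 'a list \<Rightarrow> 'a config \<Rightarrow> 'a \<Rightarrow> 'a" where
  "half_partner V h pos u = (ARG_MAX (rank h) v. v \<in> V \<and> depth (pos v) = depth (pos u) div 2)"

definition move_half_step :: "'a set \<Rightarrow> 'a list \<Rightarrow> 'a config \<Rightarrow> 'a \<Rightarrow> 'a action list" where
  "move_half_step V h pos u =
     Access u # map Swap (interchange (pos u) (pos (half_partner V h pos u)))"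

fun move_half :: "'a set \<Rightarrow> 'a list \<Rightarrow> 'a config \<Rightarrow> 'a list \<Rightarrow> 'a action list" where
  "move_half V h pos [] = []"
| "move_half V h pos (u # \<sigma>) =
     (let as = move_half_step V h pos u
      in as @ move_half V (h @ [u]) (fold perform as pos) \<sigma>)"

definition move_half_cost :: "'a set \<Rightarrow> 'a list \<Rightarrow> 'a config \<Rightarrow> 'a list \<Rightarrow> nat" where
  "move_half_cost V h pos \<sigma> = total_cost pos (move_half V h pos \<sigma>)"

text \<open>
  The swaps of \<open>interchange i j\<close> exchange the items at i and j and leave all others in place.
\<close>

lemma path_edges_range:
  assumes "1 \<le> i" "1 \<le> j" "s \<in> set (path_edges i j)"
  shows "2 \<le> s \<and> s \<le> max i j"
  using assms
proof (induction i j rule: path_edges.induct)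
  case (1 i j)
  consider "i = j" | "j < i" | "i < j" by linarith
  then show ?case
  proof cases
    case 1
    with "1.prems" show ?thesis by (simp add: path_edges.simps)
  next
    case 2
    then have eq: "path_edges i j = i # path_edges (i div 2) j"
      by (subst path_edges.simps) simp
    show ?thesis
    proof (cases "s = i")
      case False
      then have "s \<in> set (path_edges (i div 2) j)" using "1.prems" eq by simp
      moreover have "1 \<le> i div 2" using 2 "1.prems" by linarith
      ultimately have "2 \<le> s \<and> s \<le> max (i div 2) j" using "1.IH"(1) 2 "1.prems" by auto
      then show ?thesis by auto
    qed (use 2 "1.prems" in auto)
  next
    case 3
    then have eq: "path_edges i j = path_edges i (j div 2) @ [j]"
      by (subst path_edges.simps) simp
    show ?thesis
    proof (cases "s = j")
      case False
      then have "s \<in> set (path_edges i (j div 2))" using "1.prems" eq by simp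
      moreover have "1 \<le> j div 2" using 3 "1.prems" by linarith
      ultimately have "2 \<le> s \<and> s \<le> max i (j div 2)" using "1.IH"(2) 3 "1.prems" by auto
      then show ?thesis by auto
    qed (use 3 "1.prems" in auto)
  qed
qed

lemma swap_parent_apply: "swap_parent s pos v = transpose s (s div 2) (pos v)"
  by (simp add: swap_parent_def)

lemma fold_swap_parent_comp: "fold swap_parent es pos = fold swap_parent es id \<circ> pos"
  by (induction es rule: rev_induct) (simp_all add: swap_parent_def comp_assoc)

lemma fold_swap_parent_rev: "fold swap_parent (rev es) (fold swap_parent es pos) = pos"
  by (induction es arbitrary: pos) (simp_all add: swap_parent_def flip: comp_assoc)

lemma fold_swap_parent_above:
  assumes "\<forall>e \<in> set es. e < k"
  shows "fold swap_parent es id k = k"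
  using assms
proof (induction es rule: rev_induct)
  case (snoc e es)
  then show ?case by (auto simp: swap_parent_apply transpose_def id_def)
qed simp

lemma fold_path_edges:
  assumes "1 \<le> i" "1 \<le> j"
  shows "fold swap_parent (path_edges i j) id i = j"
  using assms
proof (induction i j rule: path_edges.induct)
  case (1 i j)
  consider "i = j" | "j < i" | "i < j" by linarith
  then show ?case
  proof cases
    case 1
    then show ?thesis by (simp add: path_edges.simps)
  next
    case 2
    then have eq: "path_edges i j = i # path_edges (i div 2) j"
      by (subst path_edges.simps) simp
    have "1 \<le> i div 2" using 2 "1.prems" by linarith
    with "1.IH"(1) 2 "1.prems"(2)
    have "fold swap_parent (path_edges (i div 2) j) id (i div 2) = j" by blast
    moreover have "swap_parent i id i = i div 2" by (simp add: swap_parent_def)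
    ultimately show ?thesis
      using fun_cong[OF fold_swap_parent_comp[of "path_edges (i div 2) j" "swap_parent i id"], of i]
      by (simp add: eq id_def)
  next
    case 3
    then have eq: "path_edges i j = path_edges i (j div 2) @ [j]"
      by (subst path_edges.simps) simp
    have "1 \<le> j div 2" using 3 "1.prems" by linarith
    with "1.IH"(2) 3 "1.prems"(1)
    have "fold swap_parent (path_edges i (j div 2)) id i = j div 2"
      by (metis less_asym less_irrefl_nat)
    moreover have "fold swap_parent (path_edges i j) id
        = swap_parent j (fold swap_parent (path_edges i (j div 2)) id)"
      unfolding eq by simp
    ultimately show ?thesis by (metis swap_parent_apply transpose_apply_second)
  qed
qed

lemma fold_interchange_id:
  assumes "1 \<le> i" "1 \<le> j"
  shows "fold swap_parent (interchange i j) id = transpose i j"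
  using assms
proof (induction i j rule: path_edges.induct)
  case (1 i j)
  consider "i = j" | "j < i" | "i < j" by linarith
  then show ?case
  proof cases
    case 1
    then show ?thesis by (simp add: interchange_def path_edges.simps)
  next
    case 2
    define es where "es = path_edges (i div 2) j"
    have eq: "path_edges i j = i # es"
      using 2 by (subst path_edges.simps) (simp add: es_def)
    have pos: "1 \<le> i div 2" using 2 "1.prems" by linarith
    with "1.IH"(1) 2 "1.prems"(2)
    have IH: "fold swap_parent (es @ tl (rev es)) id = transpose (i div 2) j"
      unfolding interchange_def es_def by blast
    show ?thesis
    proof (cases "es = []")
      case True
      then have "i div 2 = j" using IH by (metis append_Nil fold_simps(1) id_apply list.sel(2)
            rev.simps(1) transpose_apply_first)
      then show ?thesis using True by (simp add: interchange_def eq swap_parent_def)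
    next
      case False
      then have "i div 2 \<noteq> j" by (auto simp: es_def path_edges.simps)
      have split: "interchange i j = i # (es @ tl (rev es)) @ [i]"
        using False by (simp add: interchange_def eq)
      have "fold swap_parent (interchange i j) id
          = swap_parent i (fold swap_parent (es @ tl (rev es)) (swap_parent i id))"
        unfolding split by simp
      also have "\<dots> = swap_parent i (transpose (i div 2) j \<circ> swap_parent i id)"
        using IH fold_swap_parent_comp[of "es @ tl (rev es)" "swap_parent i id"] by simp
      also have "\<dots> = transpose i j"
        using 2 pos \<open>i div 2 \<noteq> j\<close> by (auto simp: swap_parent_def transpose_def fun_eq_iff)
      finally show ?thesis .
    qed
  next
    case 3
    define es where "es = path_edges i (j div 2)"
    define f where "f = fold swap_parent es id"
    define g where "g = fold swap_parent (rev es) id"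
    have eq: "path_edges i j = es @ [j]"
      using 3 by (subst path_edges.simps) (simp add: es_def)
    have pos: "1 \<le> j div 2" using 3 "1.prems" by linarith
    have gf: "g \<circ> f = id"
      using fold_swap_parent_rev[of es id] fold_swap_parent_comp[of "rev es" f]
      by (simp add: f_def g_def)
    have fg: "f \<circ> g = id"
      using fold_swap_parent_rev[of "rev es" id] fold_swap_parent_comp[of es g]
      by (simp add: f_def g_def)
    have fi: "f i = j div 2"
      using fold_path_edges[OF "1.prems"(1) pos] by (simp add: f_def es_def)
    have "\<forall>e \<in> set es. e < j"
      using path_edges_range[OF "1.prems"(1) pos] 3 "1.prems" by (fastforce simp: es_def)
    then have fj: "f j = j" by (simp add: f_def fold_swap_parent_above)
    have "fold swap_parent (interchange i j) id
        = fold swap_parent (rev es) (swap_parent j f)"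
      by (simp add: interchange_def eq f_def)
    also have "\<dots> = g \<circ> (transpose j (j div 2) \<circ> f)"
      using fold_swap_parent_comp[of "rev es" "swap_parent j f"]
      by (simp add: g_def swap_parent_def)
    also have "\<dots> = transpose i j"
    proof
      fix x
      have gf': "g (f y) = y" for y using gf by (simp add: fun_eq_iff)
      have inj: "f x = f y \<longleftrightarrow> x = y" for y using gf' by metis
      show "(g \<circ> (transpose j (j div 2) \<circ> f)) x = transpose i j x"
        using gf'[of i] gf'[of j] gf'[of x] inj[of i] inj[of j] fi fj
        by (auto simp: transpose_def)
    qed
    finally show ?thesis .
  qed
qed

lemma fold_interchange:
  assumes "1 \<le> i" "1 \<le> j"
  shows "fold swap_parent (interchange i j) pos = transpose i j \<circ> pos"
  using fold_interchange_id[OF assms] fold_swap_parent_comp[of _ pos] by metis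

end

theory Submission
  imports Defs
begin

text \<open>
  Both costs are compared with the working set sum \<open>W\<close> of the numbers \<open>log 2 (rank u)\<close> over all
  requests \<open>u\<close>.

  Move-Half costs at most \<open>24 W\<close>: take as potential the sum of \<open>max 0 (depth v - 3 log 2 (rank v))\<close>.
  Ranks of items other than \<open>u\<close> never decrease, the item moved down from depth \<open>d div 2\<close> to \<open>d\<close> has
  rank greater than \<open>2 ^ (d div 2)\<close> and therefore contributes nothing, and the contribution of \<open>u\<close>
  changes from at least \<open>d - 3 log 2 (rank u)\<close> to \<open>d div 2\<close>.

  Conversely, \<open>W\<close> is at most 15 times the cost of any offline algorithm: take as potential the sum
  of \<open>max 0 (log 2 (rank v) - 3 depth v)\<close>. A swap increases it by at most 3. A request to \<open>u\<close>
  removes the contribution of \<open>u\<close> and increases other ranks by at most 1, which matters only for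
  items of rank at least \<open>8 ^ depth v\<close>; as there are at most \<open>2 ^ d\<close> items of depth \<open>d\<close>, the total
  increase is bounded by a geometric series.
\<close>

section \<open>Depths of servers\<close>

lemma depth_0 [simp]: "depth 0 = 0" and depth_1 [simp]: "depth (Suc 0) = 0"
  by (simp_all add: depth.simps)

lemma depth_half: "2 \<le> s \<Longrightarrow> depth s = Suc (depth (s div 2))"
  by (subst depth.simps) simp

lemma depth_eq_iff:
  assumes "1 \<le> s"
  shows "depth s = d \<longleftrightarrow> 2 ^ d \<le> s \<and> s < 2 ^ Suc d"
  using assms
proof (induction d arbitrary: s)
  case 0
  show ?case
  proof (cases "2 \<le> s")
    case True
    then show ?thesis using depth_half[of s] by simp
  next
    case False
    then have "s = 1" using 0 by simp
    then show ?thesis by simp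
  qed
next
  case (Suc d)
  show ?case
  proof (cases "2 \<le> s")
    case True
    have "depth s = Suc d \<longleftrightarrow> 2 ^ d \<le> s div 2 \<and> s div 2 < 2 ^ Suc d"
      using Suc.IH[of "s div 2"] True by (simp add: depth_half)
    also have "\<dots> \<longleftrightarrow> 2 ^ Suc d \<le> s \<and> s < 2 ^ Suc (Suc d)" by auto
    finally show ?thesis .
  next
    case False
    then have "s = 1" using Suc.prems by simp
    moreover have "(1::nat) < 2 ^ Suc d" using one_less_power[of "2::nat" "Suc d"] by simp
    ultimately show ?thesis by (simp del: power_Suc)
  qed
qed

text \<open>Only the last level can be incomplete: an item at a depth beyond \<open>j\<close> forces
  \<open>2 ^ Suc j \<le> n\<close>, so the whole block of heap numbers of level \<open>j\<close>
  lies in \<open>{1..n}\<close>.\<close>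

lemma card_level:
  assumes "bij_betw pos V {1..n}" "x \<in> V" "j < depth (pos x)"
  shows "card {v \<in> V. depth (pos v) = j} = 2 ^ j"
proof -
  have x: "1 \<le> pos x" "pos x \<le> n"
    using bij_betwE[OF assms(1)] assms(2) by auto
  have "(2::nat) ^ Suc j \<le> 2 ^ depth (pos x)"
    using assms(3) by (intro power_increasing) auto
  also have "\<dots> \<le> n" using depth_eq_iff[OF x(1)] x(2) le_trans by blast
  finally have n: "2 ^ Suc j \<le> n" .
  have "pos ` {v \<in> V. depth (pos v) = j} = {s \<in> {1..n}. depth s = j}"
    using bij_betw_imp_surj_on[OF assms(1)] by auto
  also have "\<dots> = {2 ^ j..<2 ^ Suc j}"
  proof (intro set_eqI iffI)
    fix s assume "s \<in> {s \<in> {1..n}. depth s = j}"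
    then show "s \<in> {2 ^ j..<2 ^ Suc j}" using depth_eq_iff[of s j] by simp
  next
    fix s :: nat assume s: "s \<in> {2 ^ j..<2 ^ Suc j}"
    moreover have "(1::nat) \<le> 2 ^ j" by simp
    ultimately have "1 \<le> s" by (meson atLeastLessThan_iff le_trans)
    then show "s \<in> {s \<in> {1..n}. depth s = j}" using s n depth_eq_iff[of s j] by simp
  qed
  finally have im: "pos ` {v \<in> V. depth (pos v) = j} = {2 ^ j..<2 ^ Suc j}" .
  have "inj_on pos {v \<in> V. depth (pos v) = j}"
    using bij_betw_imp_inj_on[OF assms(1)] by (rule inj_on_subset) auto
  from card_image[OF this] show ?thesis unfolding im by simp
qed

text \<open>At most \<open>2 ^ d\<close> servers have depth \<open>d\<close>, each of weight
  \<open>(1/8) ^ d\<close>, so the series is geometric with ratio 1/4. The induction follows the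
  heap recursion, and 4/3 is the fixed point of \<open>x = 1 + x/4\<close>.\<close>

lemma sum_inverse_depth: "(\<Sum>s=1..n. (1/8::real) ^ depth s) \<le> 4/3"
proof (induction n rule: less_induct)
  case (less n)
  show ?case
  proof (cases "n \<le> 1")
    case True
    then consider "n = 0" | "n = 1" by linarith
    then show ?thesis by cases simp_all
  next
    case False
    \<comment> \<open>Servers other than the root are the children \<open>2 * s\<close> and
      \<open>2 * s + 1\<close> of \<open>s\<close> in \<open>{1..m}\<close>; two children with an
      eighth of the weight each give the factor 1/4.\<close>
    have split: "(\<Sum>s=1..2 * m + 1. (1/8::real) ^ depth s)
        = 1 + 1/4 * (\<Sum>s=1..m. (1/8::real) ^ depth s)" for m
    proof (induction m)
      case (Suc m)
      have "{1..2 * Suc m + 1} = insert (2 * m + 3) (insert (2 * m + 2) {1..2 * m + 1})" by auto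
      moreover have "depth (2 * m + 3) = Suc (depth (Suc m))" "depth (2 * m + 2) = Suc (depth (Suc m))"
        using depth_half[of "2 * m + 3"] depth_half[of "2 * m + 2"] by simp_all
      ultimately show ?case using Suc.IH by (simp add: algebra_simps)
    qed simp
    have "(\<Sum>s=1..n. (1/8::real) ^ depth s) \<le> (\<Sum>s=1..2 * (n div 2) + 1. (1/8::real) ^ depth s)"
      by (rule sum_mono2) auto
    also have "\<dots> \<le> 1 + 1/4 * (4/3)"
      unfolding split using less.IH[of "n div 2"] False by simp
    finally show ?thesis by simp
  qed
qed

section \<open>Ranks and the working set bound\<close>

definition recent :: "'a list \<Rightarrow> 'a \<Rightarrow> 'a set" where
  "recent h v = insert v (set (takeWhile (\<lambda>w. w \<noteq> v) (rev h)))"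

lemma rank_recent: "rank h v = card (recent h v)"
  by (simp add: rank_def recent_def)

lemma finite_recent [simp]: "finite (recent h v)"
  by (simp add: recent_def)

lemma rank_pos: "0 < rank h v"
  by (simp add: rank_def card_gt_0_iff)

lemma recent_snoc: "recent (h @ [u]) v = (if v = u then {u} else insert u (recent h v))"
  by (auto simp: recent_def)

lemma rank_snoc_self: "rank (h @ [u]) u = 1"
  by (simp add: rank_recent recent_snoc)

lemma rank_snoc_ge: "v \<noteq> u \<Longrightarrow> rank h v \<le> rank (h @ [u]) v"
  by (simp add: rank_recent recent_snoc card_insert_if)

lemma rank_snoc_le: "rank (h @ [u]) v \<le> Suc (rank h v)"
  by (simp add: rank_recent recent_snoc card_insert_if)

text \<open>Rank 1 means that no other item followed the last request of \<open>u\<close>. Such a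
  request only repeats the previous one, which is how it is used below.\<close>

lemma rank_1_imp_last:
  assumes "u \<in> set h" "rank h u = 1"
  shows "\<exists>h'. h = h' @ [u]"
proof -
  have "recent h u = {u}"
    using assms(2) by (metis rank_recent card_1_singletonE insertI1 recent_def singletonD)
  then have "set (takeWhile (\<lambda>w. w \<noteq> u) (rev h)) \<subseteq> {u}"
    by (auto simp: recent_def)
  moreover have "u \<notin> set (takeWhile (\<lambda>w. w \<noteq> u) (rev h))"
    using set_takeWhileD[of u "\<lambda>w. w \<noteq> u" "rev h"] by blast
  ultimately have "set (takeWhile (\<lambda>w. w \<noteq> u) (rev h)) = {}"
    by (metis subset_singletonD insertI1)
  then have empty: "takeWhile (\<lambda>w. w \<noteq> u) (rev h) = []" by (simp only: set_empty)
  show ?thesis using empty assms(1) by (cases h rule: rev_cases) (auto split: if_splits)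
qed

text \<open>Recent sets are nested: if \<open>w\<close> was not requested since \<open>v\<close>,
  then looking back as far as \<open>w\<close> passes everything seen up to \<open>v\<close> and
  adds \<open>w\<close>, so \<open>w\<close> has strictly larger rank.\<close>

lemma recent_if_rank_le:
  assumes "w \<in> set h" "rank h w \<le> rank h v"
  shows "w \<in> recent h v"
proof (rule ccontr)
  assume w: "w \<notin> recent h v"
  then have "w \<noteq> v" by (auto simp: recent_def)
  have "v \<in> set h"
  proof (rule ccontr)
    assume "v \<notin> set h"
    then have "\<forall>x \<in> set (rev h). x \<noteq> v" by auto
    then have "takeWhile (\<lambda>w. w \<noteq> v) (rev h) = rev h" by (simp only: takeWhile_eq_all_conv)
    then have "set (rev h) \<subseteq> recent h v" unfolding recent_def by (metis subset_insertI)
    then show False using w assms(1) by auto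
  qed
  then obtain xs ys where h: "rev h = xs @ v # ys" "v \<notin> set xs"
    by (metis set_rev split_list_first)
  have tv: "takeWhile (\<lambda>w. w \<noteq> v) (rev h) = xs"
    using h by (auto simp: takeWhile_append)
  then have "w \<notin> set xs" using w by (auto simp: recent_def)
  then have "takeWhile (\<lambda>x. x \<noteq> w) (rev h) = xs @ v # takeWhile (\<lambda>x. x \<noteq> w) ys"
    using h \<open>w \<noteq> v\<close> by (auto simp: takeWhile_append)
  then have "insert w (recent h v) \<subseteq> recent h w" using tv by (auto simp: recent_def)
  then have "card (insert w (recent h v)) \<le> card (recent h w)" by (rule card_mono[rotated]) simp
  then show False using assms(2) w by (simp add: rank_recent)
qed

definition lrank :: "'a list \<Rightarrow> 'a \<Rightarrow> real" where
  "lrank h v = log 2 (real (rank h v))"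

lemma lrank_nonneg: "0 \<le> lrank h v"
  using rank_pos[of h v] by (simp add: lrank_def)

lemma lrank_snoc_self [simp]: "lrank (h @ [u]) u = 0"
  by (simp add: lrank_def rank_snoc_self)

lemma lrank_snoc_ge: "v \<noteq> u \<Longrightarrow> lrank h v \<le> lrank (h @ [u]) v"
  using rank_snoc_ge[of v u h] rank_pos[of h v] by (simp add: lrank_def)

lemma mru_tree_depth:
  assumes "mru_tree V h pos" "v \<in> V"
  shows "real (depth (pos v)) \<le> lrank h v" "lrank h v < real (depth (pos v)) + 1"
proof -
  have "int (depth (pos v)) = \<lfloor>lrank h v\<rfloor>"
    using assms by (simp add: mru_tree_def lrank_def)
  then show "real (depth (pos v)) \<le> lrank h v" "lrank h v < real (depth (pos v)) + 1"
    by linarith+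
qed

fun working_set_bound :: "'a list \<Rightarrow> 'a list \<Rightarrow> real" where
  "working_set_bound h [] = 0"
| "working_set_bound h (u # \<sigma>) = lrank h u + working_set_bound (h @ [u]) \<sigma>"

section \<open>Lower bound for offline algorithms\<close>

definition rank_excess :: "'a list \<Rightarrow> 'a config \<Rightarrow> 'a \<Rightarrow> real" where
  "rank_excess h pos v = max 0 (lrank h v - 3 * real (depth (pos v)))"

lemma rank_excess_snoc:
  assumes "v \<noteq> u"
  shows "rank_excess (h @ [u]) pos v \<le> rank_excess h pos v + 2 * (1/8) ^ depth (pos v)"
proof -
  define r where "r = rank h v"
  define d where "d = depth (pos v)"
  have r: "0 < r" by (simp add: r_def rank_pos)
  have le: "lrank (h @ [u]) v \<le> log 2 (real r + 1)"
  proof -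
    have "real (rank (h @ [u]) v) \<le> real r + 1" using rank_snoc_le[of h u v] by (simp add: r_def)
    then show ?thesis using rank_pos[of "h @ [u]" v] by (simp add: lrank_def)
  qed
  show ?thesis
  proof (cases "r < 8 ^ d")
    case True
    \<comment> \<open>By integrality a rank below \<open>8 ^ d\<close> can at most reach
      \<open>8 ^ d\<close>, where the excess is still 0.\<close>
    then have "real (r + 1) \<le> real (8 ^ d)" by (intro of_nat_mono) simp
    then have "log 2 (real r + 1) \<le> log 2 (8 ^ d)" by (simp add: add.commute)
    also have "\<dots> = 3 * real d"
    proof -
      have "(8::real) ^ d = 2 ^ (3 * d)" by (simp add: power_mult)
      then show ?thesis by simp
    qed
    finally show ?thesis using le by (simp add: rank_excess_def d_def)
  next
    case False
    then have "real (8 ^ d) \<le> real r" by (intro of_nat_mono) simp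
    then have big: "(8::real) ^ d \<le> real r" by simp
    have "log 2 (real r + 1) - log 2 (real r) = ln (1 + 1 / real r) / ln 2"
    proof -
      have "1 + 1 / real r = (real r + 1) / real r" using r by (simp add: field_simps)
      then show ?thesis using r by (simp add: log_def ln_div diff_divide_distrib)
    qed
    also have "\<dots> \<le> (1 / real r) / ln 2"
      using r by (intro divide_right_mono ln_add_one_self_le_self) auto
    \<comment> \<open>The bound \<open>ln 2 \<ge> 1/2\<close> is the origin of the factor 2 in the
      statement.\<close>
    also have "\<dots> \<le> (1 / real r) / (1/2)"
    proof -
      have "ln (1/2) \<le> (1/2 :: real) - 1" by (rule ln_le_minus_one) simp
      then have "1/2 \<le> ln (2::real)" by (simp add: ln_div)
      then show ?thesis by (intro divide_left_mono) auto
    qed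
    also have "\<dots> \<le> (1 / 8 ^ d) / (1/2)"
      using big r by (intro divide_right_mono divide_left_mono) auto
    also have "\<dots> = 2 * (1/8) ^ d" by (simp add: power_divide)
    finally have "lrank (h @ [u]) v \<le> lrank h v + 2 * (1/8) ^ d"
      using le by (simp add: lrank_def r_def)
    moreover have "(0::real) \<le> 2 * (1/8) ^ d" by simp
    ultimately show ?thesis by (simp add: rank_excess_def d_def)
  qed
qed

text \<open>A request of rank 1 changes no rank. Any other has \<open>lrank h u \<ge> 1\<close>; the
  vanishing excess of \<open>u\<close>, taken three times, pays for \<open>lrank h u\<close> and
  leaves \<open>2 * lrank h u - 9 * d\<close> towards the growth of the other excesses.\<close>

lemma rank_excess_access:
  assumes "finite V" "bij_betw pos V {1..n}" "set h = V" "u \<in> V"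
  shows "lrank h u + 3 * sum (rank_excess (h @ [u]) pos) V
    \<le> 15 * real (depth (pos u)) + 3 * sum (rank_excess h pos) V"
proof (cases "rank h u = 1")
  case True
  then obtain h' where h': "h = h' @ [u]" using rank_1_imp_last assms by metis
  have "recent (h @ [u]) v = recent h v" for v by (simp add: h' recent_snoc del: append_assoc)
  then have "rank_excess (h @ [u]) pos v = rank_excess h pos v" for v
    by (simp add: rank_excess_def lrank_def rank_recent)
  then show ?thesis using True by (simp add: lrank_def)
next
  case False
  define d where "d = depth (pos u)"
  have "2 \<le> rank h u" using False rank_pos[of h u] by linarith
  then have lr: "1 \<le> lrank h u" by (simp add: lrank_def)
  have "sum (rank_excess (h @ [u]) pos) V
      = rank_excess (h @ [u]) pos u + sum (rank_excess (h @ [u]) pos) (V - {u})"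
    using assms by (simp add: sum.remove)
  also have "\<dots> = sum (rank_excess (h @ [u]) pos) (V - {u})"
    by (simp add: rank_excess_def)
  also have "\<dots> \<le> (\<Sum>v\<in>V - {u}. rank_excess h pos v + 2 * (1/8) ^ depth (pos v))"
    by (intro sum_mono rank_excess_snoc) auto
  also have "\<dots> = sum (rank_excess h pos) (V - {u})
      + 2 * (\<Sum>v\<in>V - {u}. (1/8) ^ depth (pos v))"
    by (simp add: sum.distrib sum_distrib_left)
  \<comment> \<open>The term of \<open>u\<close> itself must stay subtracted: at the root it lowers
    the series bound from 4/3 to 1/3.\<close>
  also have "\<dots> = sum (rank_excess h pos) V - rank_excess h pos u
      + 2 * ((\<Sum>v\<in>V. (1/8) ^ depth (pos v)) - (1/8) ^ d)"
    using assms by (simp add: sum_diff1 d_def)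
  also have "(\<Sum>v\<in>V. (1/8::real) ^ depth (pos v)) = (\<Sum>s=1..n. (1/8) ^ depth s)"
    by (rule sum.reindex_bij_betw[OF assms(2)])
  also have "\<dots> \<le> 4/3" by (rule sum_inverse_depth)
  finally have step: "sum (rank_excess (h @ [u]) pos) V
      \<le> sum (rank_excess h pos) V - rank_excess h pos u + 2 * (4/3 - (1/8) ^ d)"
    by simp
  have ex: "lrank h u - 3 * real d \<le> rank_excess h pos u" by (simp add: rank_excess_def d_def)
  show ?thesis
  proof (cases "d = 0")
    \<comment> \<open>Here the tripled growth is at most 3 * 2 * (1/3) = 2, which is covered by
      \<open>2 * lrank h u\<close>.\<close>
    case True
    then show ?thesis using step ex lr by (simp add: d_def)
  next
    case False
    \<comment> \<open>What remains is at most \<open>9 * d + 8 - 2 * lrank h u\<close>, hence at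
      most \<open>9 * d + 6\<close> and so at most \<open>15 * d\<close>.\<close>
    then have "1 \<le> real d" by simp
    moreover have "(0::real) \<le> (1/8) ^ d" by simp
    ultimately show ?thesis using step ex lr unfolding d_def[symmetric] by argo
  qed
qed

text \<open>Only the item moving up from \<open>s\<close> can gain, by 3 for the one level it rises;
  injectivity allows just one such item.\<close>

lemma rank_excess_swap:
  assumes "finite V" "inj_on pos V" "2 \<le> s"
  shows "sum (rank_excess h (swap_parent s pos)) V \<le> 3 + sum (rank_excess h pos) V"
proof -
  have "rank_excess h (swap_parent s pos) v \<le> rank_excess h pos v + (if pos v = s then 3 else 0)"
    for v
  proof -
    define p where "p = s div 2"
    have s: "depth s = Suc (depth p)" "p \<noteq> s"
      using depth_half[OF assms(3)] assms(3) by (simp_all add: p_def)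
    consider "pos v = s" | "pos v = p" | "pos v \<noteq> s" "pos v \<noteq> p" by blast
    then show ?thesis
      using s by cases (simp_all add: rank_excess_def swap_parent_apply flip: p_def)
  qed
  then have "sum (rank_excess h (swap_parent s pos)) V
      \<le> (\<Sum>v\<in>V. rank_excess h pos v + (if pos v = s then 3 else 0))"
    by (intro sum_mono)
  also have "\<dots> = sum (rank_excess h pos) V + 3 * real (card {v \<in> V. pos v = s})"
    using assms(1) by (simp add: sum.distrib sum.If_cases Int_def)
  also have "card {v \<in> V. pos v = s} \<le> 1"
  proof -
    have "card {v \<in> V. pos v = s} = card (pos ` {v \<in> V. pos v = s})"
      using assms(2) by (intro card_image[symmetric]) (auto simp: inj_on_def)
    also have "\<dots> \<le> card {s}" by (intro card_mono) auto
    finally show ?thesis by simp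
  qed
  finally show ?thesis by simp
qed

lemma bij_betw_transpose_comp:
  assumes "bij_betw pos V {1..n}" "i \<in> {1..n}" "j \<in> {1..n}"
  shows "bij_betw (transpose i j \<circ> pos) V {1..n}"
  using assms by (intro bij_betw_trans[OF assms(1)] bij_betw_transpose_iff) simp

text \<open>Telescoping of the potential over arbitrary action lists. A swap raises the tripled
  potential by at most 9, within the 15 allotted to it.\<close>

lemma working_set_bound_le_cost:
  assumes "finite V" "bij_betw pos V {1..n}" "set h = V" "set (accesses as) \<subseteq> V"
    "\<forall>s. Swap s \<in> set as \<longrightarrow> 2 \<le> s \<and> s \<le> n"
  shows "working_set_bound h (accesses as)
    \<le> 15 * real (total_cost pos as) + 3 * sum (rank_excess h pos) V"
  using assms(2-)
proof (induction as arbitrary: h pos)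
  case Nil
  then show ?case by (simp add: sum_nonneg rank_excess_def)
next
  case (Cons a as)
  show ?case
  proof (cases a)
    case (Access u)
    then have u: "u \<in> V" using Cons.prems by simp
    have "working_set_bound (h @ [u]) (accesses as)
        \<le> 15 * real (total_cost pos as) + 3 * sum (rank_excess (h @ [u]) pos) V"
      using Cons.prems Access by (intro Cons.IH) auto
    then show ?thesis
      using rank_excess_access[OF assms(1) Cons.prems(1,2) u] by (simp add: Access)
  next
    case (Swap s)
    then have s: "2 \<le> s" "s \<le> n" using Cons.prems by auto
    have "bij_betw (swap_parent s pos) V {1..n}"
      unfolding swap_parent_def using s Cons.prems(1) by (intro bij_betw_transpose_comp) auto
    then have "working_set_bound h (accesses as)
        \<le> 15 * real (total_cost (swap_parent s pos) as)
          + 3 * sum (rank_excess h (swap_parent s pos)) V"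
      using Cons.prems Swap by (intro Cons.IH) auto
    then show ?thesis
      using rank_excess_swap[OF assms(1) bij_betw_imp_inj_on[OF Cons.prems(1)] s(1), of h]
      by (simp add: Swap)
  qed
qed

lemma working_set_bound_le_opt:
  assumes "finite V" "bij_betw pos V {1..n}" "set h = V" "mru_tree V h pos" "set \<sigma> \<subseteq> V"
  shows "working_set_bound h \<sigma> \<le> 15 * real (opt_cost n pos \<sigma>)"
proof -
  obtain as where as: "serves n \<sigma> as" "total_cost pos as = opt_cost n pos \<sigma>"
    using opt_cost_attained by blast
  have "rank_excess h pos v = 0" if "v \<in> V" for v
  \<comment> \<open>In an MRU tree \<open>lrank h v\<close> is below depth plus 1, which is at most
    three times the depth except at the root; there integrality forces rank 1.\<close>
  proof (cases "depth (pos v) = 0")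
    case True
    have "lrank h v < 1" using mru_tree_depth[OF assms(4) that] True by simp
    then have "rank h v < 2" using rank_pos[of h v] by (simp add: lrank_def log_less_one_cancel_iff)
    then have "rank h v = 1" using rank_pos[of h v] by simp
    then show ?thesis by (simp add: rank_excess_def lrank_def)
  next
    case False
    then have "1 \<le> real (depth (pos v))" by simp
    then show ?thesis using mru_tree_depth[OF assms(4) that] by (simp add: rank_excess_def)
  qed
  then have "sum (rank_excess h pos) V = 0" by simp
  then show ?thesis
    using working_set_bound_le_cost[OF assms(1-3), of as] as assms(5) by (simp add: serves_def)
qed

section \<open>Upper bound for Move-Half\<close>

lemma total_cost_append:
  "total_cost pos (as @ bs) = total_cost pos as + total_cost (fold perform as pos) bs"
  by (induction as arbitrary: pos) simp_all

lemma total_cost_map_Swap: "total_cost pos (map Swap es) = length es"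
  by (induction es arbitrary: pos) simp_all

lemma fold_perform_map_Swap: "fold perform (map Swap es) pos = fold swap_parent es pos"
  by (induction es arbitrary: pos) simp_all

lemma length_path_edges:
  assumes "1 \<le> i" "1 \<le> j"
  shows "length (path_edges i j) \<le> depth i + depth j"
  using assms
proof (induction i j rule: path_edges.induct)
  case (1 i j)
  consider "i = j" | "j < i" | "i < j" by linarith
  then show ?case
  proof cases
    case 1
    then show ?thesis by (simp add: path_edges.simps)
  next
    case 2
    have "length (path_edges (i div 2) j) \<le> depth (i div 2) + depth j"
      using 2 "1.prems" by (intro "1.IH"(1)) auto
    then show ?thesis
      using 2 "1.prems" by (subst path_edges.simps) (simp add: depth_half[of i])
  next
    case 3
    have "length (path_edges i (j div 2)) \<le> depth i + depth (j div 2)"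
      using 3 "1.prems" by (intro "1.IH"(2)) auto
    then show ?thesis
      using 3 "1.prems" by (subst path_edges.simps) (simp add: depth_half[of j])
  qed
qed

lemma length_interchange:
  assumes "1 \<le> i" "1 \<le> j"
  shows "length (interchange i j) \<le> 2 * (depth i + depth j)"
  using length_path_edges[OF assms] by (simp add: interchange_def)

text \<open>The choice by \<open>ARG_MAX\<close> is meaningful because the target level is finite
  and nonempty: it contains \<open>u\<close> if \<open>u\<close> is at the root, and is a full level
  otherwise.\<close>

lemma half_partner:
  fixes h :: "'a list"
  assumes "finite V" "bij_betw pos V {1..n}" "u \<in> V"
  defines "v \<equiv> half_partner V h pos u"
  shows "v \<in> V" "depth (pos v) = depth (pos u) div 2"
    "\<And>w. w \<in> V \<Longrightarrow> depth (pos w) = depth (pos u) div 2 \<Longrightarrow> rank h w \<le> rank h v"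
proof -
  define L where "L = {w \<in> V. depth (pos w) = depth (pos u) div 2}"
  have "L \<noteq> {}"
  proof (cases "depth (pos u) = 0")
    case True
    then show ?thesis using assms(3) by (auto simp: L_def)
  next
    case False
    then have "card L = 2 ^ (depth (pos u) div 2)"
      unfolding L_def using assms by (intro card_level) auto
    then show ?thesis by auto
  qed
  moreover have "finite L" using assms(1) by (simp add: L_def)
  ultimately have "Max (rank h ` L) \<in> rank h ` L" "\<forall>w\<in>L. rank h w \<le> Max (rank h ` L)"
    by auto
  then obtain x where x: "x \<in> L" "\<forall>w\<in>L. rank h w \<le> rank h x" by auto
  have "is_arg_max (rank h) (\<lambda>w. w \<in> V \<and> depth (pos w) = depth (pos u) div 2) x"
    using x by (force simp: is_arg_max_linorder L_def)
  then have "is_arg_max (rank h) (\<lambda>w. w \<in> V \<and> depth (pos w) = depth (pos u) div 2) v"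
    unfolding v_def half_partner_def arg_max_def by (rule someI)
  then show "v \<in> V" "depth (pos v) = depth (pos u) div 2"
    "\<And>w. w \<in> V \<Longrightarrow> depth (pos w) = depth (pos u) div 2 \<Longrightarrow> rank h w \<le> rank h v"
    by (auto simp: is_arg_max_linorder)
qed

text \<open>As \<open>v\<close> has maximal rank on its level, all \<open>2 ^ j\<close> items there
  belong to its recent set; the request to \<open>u\<close>, which lies deeper, adds one
  more.\<close>

lemma rank_half_partner:
  assumes "finite V" "bij_betw pos V {1..n}" "set h = V" "u \<in> V" "0 < depth (pos u)"
  shows "2 ^ (depth (pos u) div 2) < rank (h @ [u]) (half_partner V h pos u)"
proof -
  define j where "j = depth (pos u) div 2"
  define v where "v = half_partner V h pos u"
  define L where "L = {w \<in> V. depth (pos w) = j}"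
  note hp = half_partner[OF assms(1,2,4), where h = h, folded v_def j_def]
  have j: "j < depth (pos u)" using assms(5) by (simp add: j_def)
  then have u: "u \<notin> L" "v \<noteq> u" using hp(2) by (auto simp: L_def)
  have "L \<subseteq> recent h v" using hp(3) recent_if_rank_le[of _ h v] assms(3) by (auto simp: L_def)
  then have "insert u L \<subseteq> recent (h @ [u]) v" using u by (auto simp: recent_snoc)
  then have "card (insert u L) \<le> rank (h @ [u]) v"
    unfolding rank_recent by (rule card_mono[rotated]) simp
  moreover have "card L = 2 ^ j"
    unfolding L_def by (rule card_level[OF assms(2,4) j])
  moreover have "finite L" using assms(1) by (simp add: L_def)
  ultimately show ?thesis using u by (simp add: j_def v_def)
qed

definition depth_excess :: "'a list \<Rightarrow> 'a config \<Rightarrow> 'a \<Rightarrow> real" where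
  "depth_excess h pos v = max 0 (real (depth (pos v)) - 3 * lrank h v)"

lemma move_half_step_positions:
  assumes "finite V" "bij_betw pos V {1..n}" "u \<in> V"
  shows "fold perform (move_half_step V h pos u) pos
    = transpose (pos u) (pos (half_partner V h pos u)) \<circ> pos"
proof -
  have "1 \<le> pos u" "1 \<le> pos (half_partner V h pos u)"
    using bij_betwE[OF assms(2)] assms(3) half_partner(1)[OF assms] by auto
  then show ?thesis
    by (simp add: move_half_step_def fold_perform_map_Swap fold_interchange)
qed

text \<open>The access costs \<open>d\<close>, and the interchange at most
  \<open>2 * (d + d div 2)\<close>, which is at most \<open>3 * d\<close>.\<close>

lemma move_half_step_cost:
  assumes "finite V" "bij_betw pos V {1..n}" "u \<in> V"
  shows "total_cost pos (move_half_step V h pos u) \<le> 4 * depth (pos u)"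
proof -
  have "1 \<le> pos u" "1 \<le> pos (half_partner V h pos u)"
    using bij_betwE[OF assms(2)] assms(3) half_partner(1)[OF assms] by auto
  from length_interchange[OF this] show ?thesis
    using half_partner(2)[OF assms]
    by (simp add: move_half_step_def total_cost_map_Swap)
qed

lemma depth_excess_step:
  assumes "finite V" "bij_betw pos V {1..n}" "set h = V" "u \<in> V"
  defines "pos' \<equiv> fold perform (move_half_step V h pos u) pos"
  shows "2 * sum (depth_excess (h @ [u]) pos') V + real (depth (pos u))
    \<le> 2 * sum (depth_excess h pos) V + 6 * lrank h u"
proof -
  define d where "d = depth (pos u)"
  define v where "v = half_partner V h pos u"
  note hp = half_partner[OF assms(1,2,4), where h = h, folded v_def d_def]
  have pos': "pos' = transpose (pos u) (pos v) \<circ> pos"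
    unfolding pos'_def v_def by (rule move_half_step_positions[OF assms(1,2,4)])
  have inj: "pos w = pos x \<longleftrightarrow> w = x" if "w \<in> V" "x \<in> V" for w x
    using bij_betw_imp_inj_on[OF assms(2)] that by (auto simp: inj_on_eq_iff)
  \<comment> \<open>The request resets \<open>lrank\<close> of \<open>u\<close> to 0, so its whole
    new depth counts.\<close>
  have self: "depth_excess (h @ [u]) pos' u = real (d div 2)"
    using hp(2) by (simp add: depth_excess_def pos')
  have other: "depth_excess (h @ [u]) pos' w \<le> depth_excess h pos w" if w: "w \<in> V - {u}" for w
  proof (cases "w = v")
    case False
    then have "pos' w = pos w" using w inj[of w u] inj[of w v] assms(4) hp(1)
      by (simp add: pos' transpose_def)
    then show ?thesis using w lrank_snoc_ge[of w u h] by (auto simp: depth_excess_def)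
  next
    case True
    \<comment> \<open>At the root \<open>u\<close> would be its own partner, contrary to
      \<open>w \<noteq> u\<close>.\<close>
    have d: "0 < d"
    proof (rule ccontr)
      assume "\<not> 0 < d"
      then have "depth (pos u) = 0" "depth (pos v) = 0" using hp(2) by (simp_all add: d_def)
      moreover have "1 \<le> pos u" "1 \<le> pos v"
        using bij_betwE[OF assms(2)] assms(4) hp(1) by auto
      ultimately have "pos u = pos v"
        using depth_eq_iff[of "pos u" 0] depth_eq_iff[of "pos v" 0] by simp
      then show False using inj[OF assms(4) hp(1)] True w by simp
    qed
    have rk: "2 ^ (d div 2) < rank (h @ [u]) v"
      using rank_half_partner[OF assms(1-4)] d by (simp add: d_def v_def)
    have "real d \<le> 3 * lrank (h @ [u]) v"
    \<comment> \<open>For \<open>d = 1\<close> the half depth is 0 and the strict rank bound is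
      needed to get rank 2. For \<open>d \<ge> 2\<close> one has
      \<open>d \<le> 3 * (d div 2)\<close>, with equality at \<open>d = 3\<close>, so the factor 3
      in \<open>depth_excess\<close> cannot be lowered in this estimate.\<close>
    proof (cases "d = 1")
      case True
      then have "2 \<le> rank (h @ [u]) v" using rk by simp
      then have "1 \<le> lrank (h @ [u]) v" by (simp add: lrank_def)
      then show ?thesis using True by simp
    next
      case False
      have "real (d div 2) = log 2 (2 ^ (d div 2))" by simp
      also have "\<dots> \<le> lrank (h @ [u]) v"
        unfolding lrank_def using rk
        by (subst log_le_cancel_iff) (auto simp: numeral_power_le_of_nat_cancel_iff)
      finally have "3 * real (d div 2) \<le> 3 * lrank (h @ [u]) v" by simp
      moreover have "real d \<le> real (3 * (d div 2))"
        using d False by (intro of_nat_mono) linarith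
      ultimately show ?thesis by simp
    qed
    then have "depth_excess (h @ [u]) pos' v = 0"
      by (simp add: depth_excess_def pos' d_def)
    then show ?thesis by (simp add: True depth_excess_def)
  qed
  have "sum (depth_excess (h @ [u]) pos') V
      = real (d div 2) + sum (depth_excess (h @ [u]) pos') (V - {u})"
    using assms(1,4) by (simp add: sum.remove self)
  also have "\<dots> \<le> real (d div 2) + sum (depth_excess h pos) (V - {u})"
    using other by (intro add_left_mono sum_mono)
  also have "\<dots> = real (d div 2) + sum (depth_excess h pos) V - depth_excess h pos u"
    using assms(1,4) by (simp add: sum_diff1)
  finally have "sum (depth_excess (h @ [u]) pos') V
      \<le> real (d div 2) + sum (depth_excess h pos) V - depth_excess h pos u" .
  moreover have "real d - 3 * lrank h u \<le> depth_excess h pos u"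
    by (simp add: depth_excess_def d_def)
  \<comment> \<open>After doubling, \<open>u\<close> releases at least
    \<open>2 * d - 6 * lrank h u\<close> and takes back at most \<open>d\<close>, which leaves
    \<open>d\<close> to pay for the step.\<close>
  moreover have "2 * real (d div 2) \<le> real d" by linarith
  ultimately show ?thesis unfolding d_def[symmetric] by argo
qed

text \<open>Four times the amortized inequality \<open>depth_excess_step\<close> covers the step
  cost of at most four times the depth, whence 24 = 4 * 6 and 8 = 4 * 2.\<close>

lemma move_half_cost_le:
  assumes "finite V" "bij_betw pos V {1..n}" "set h = V" "set \<sigma> \<subseteq> V"
  shows "real (move_half_cost V h pos \<sigma>)
    \<le> 24 * working_set_bound h \<sigma> + 8 * sum (depth_excess h pos) V"
  using assms(2-)
proof (induction \<sigma> arbitrary: h pos)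
  case Nil
  then show ?case by (simp add: move_half_cost_def sum_nonneg depth_excess_def)
next
  case (Cons u \<sigma>)
  define as where "as = move_half_step V h pos u"
  define pos' where "pos' = fold perform as pos"
  have u: "u \<in> V" using Cons.prems by simp
  have "bij_betw pos' V {1..n}"
    unfolding pos'_def as_def move_half_step_positions[OF assms(1) Cons.prems(1) u]
    using bij_betwE[OF Cons.prems(1)] u half_partner(1)[OF assms(1) Cons.prems(1) u] Cons.prems(1)
    by (intro bij_betw_transpose_comp) auto
  then have "real (move_half_cost V (h @ [u]) pos' \<sigma>)
      \<le> 24 * working_set_bound (h @ [u]) \<sigma> + 8 * sum (depth_excess (h @ [u]) pos') V"
    using Cons.prems by (intro Cons.IH) auto
  moreover have "move_half_cost V h pos (u # \<sigma>)
      = total_cost pos as + move_half_cost V (h @ [u]) pos' \<sigma>"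
    by (simp add: move_half_cost_def as_def pos'_def total_cost_append Let_def)
  moreover have "real (total_cost pos as) \<le> 4 * real (depth (pos u))"
    using move_half_step_cost[OF assms(1) Cons.prems(1) u, of h] by (simp add: as_def)
  moreover have "2 * sum (depth_excess (h @ [u]) pos') V + real (depth (pos u))
      \<le> 2 * sum (depth_excess h pos) V + 6 * lrank h u"
    unfolding pos'_def as_def by (rule depth_excess_step[OF assms(1) Cons.prems(1,2) u])
  ultimately show ?case by simp
qed

theorem theorem2:
  shows "\<exists>c::real. \<forall>(n::nat) (V::'a set) (h::'a list) (pos::'a config) (\<sigma>::'a list).
    finite V \<and> card V = n \<and> bij_betw pos V {1..n} \<and>
    set h = V \<and> mru_tree V h pos \<and> set \<sigma> \<subseteq> V
    \<longrightarrow> real (move_half_cost V h pos \<sigma>) \<le> c * real (opt_cost n pos \<sigma>)"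
\<comment> \<open>The constant is 360 = 24 * 15; both potentials vanish on the initial MRU
  tree.\<close>
proof (intro exI[of _ 360] allI impI, elim conjE)
  fix n and V :: "'a set" and h :: "'a list" and pos :: "'a config" and \<sigma> :: "'a list"
  assume A: "finite V" "bij_betw pos V {1..n}" "set h = V" "mru_tree V h pos" "set \<sigma> \<subseteq> V"
  have "depth_excess h pos v = 0" if "v \<in> V" for v
    using mru_tree_depth(1)[OF A(4) that] lrank_nonneg[of h v] by (simp add: depth_excess_def)
  then have "sum (depth_excess h pos) V = 0" by simp
  then have "real (move_half_cost V h pos \<sigma>) \<le> 24 * working_set_bound h \<sigma>"
    using move_half_cost_le[OF A(1-3,5)] by simp
  also have "\<dots> \<le> 360 * real (opt_cost n pos \<sigma>)"
    using working_set_bound_le_opt[OF A] by simp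
  finally show "real (move_half_cost V h pos \<sigma>) \<le> 360 * real (opt_cost n pos \<sigma>)" .
qed

end
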